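(* Let $m\in\mathbb N\setminus6\mathbb N$. Let $p$ be a prime such that $p>\min\bigl(2^m-1,3^{\phi(m)}\bigr)$. Assume that at least one of the following conditions (1) to (6) does not hold (e.g., $m\nmid p-1$): (1) We have $5\le m<2^m\le p\le3^{\phi(m)}$ and $m$ is odd. (2) We have $\mathcal Z_m/p\mathcal Z_m\cong\mathbb F_p^{\phi(m)}$ and $m\mid p-1$. (3) We have $t_{m,p;1}\in2\mathbb N$. (4) With $\zeta\in\mathbb F_p\setminus\{0\}$ a primitive $m$-th root of unity, for each $[l]_m\in U_m\setminus\{[1]_m\}$ we have $\Omega_{m,p,\zeta;1}\cap([l]_m\Omega_{m,p,\zeta;1})=\emptyset$. (5) For each $(i,j)\in\Omega_{m,p,\zeta;1}$ (with $\zeta$ as in (4)), the stabilizer of $\zeta_m^i+\zeta_m^j$ in the Galois group $\mathrm{Gal}(\mathbb Q(\zeta_m)/\mathbb Q)$ is trivial. (6) We have $|\mathbb K_m|\ge2t_{m,p;1}[\phi(m)-1]$ and $t_{m,p;1}[\phi(m)-1]\le(m-1)(m-3)$. Then there exist no $m$-th roots of unity $x$ and $y$ in $\overline{\mathbb F_p}$ such that $x+y=1$.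
   Context: $\mathbb N$ is the set of positive integers; $\phi$ is Euler's totient function; $\zeta_m:=e^{2\pi i/m}\in\mathbb C$; $\mathcal Z_m:=\mathbb Z[\zeta_m]$. $t_{m,p;1}$ is the degree of the monic greatest common divisor in $\mathbb F_p[X]$ of $X^m-1$ and $(1-X)^m-1$. For $n\in\mathbb N\cup\{0\}$, $\mathbb I_n:=\{0,\ldots,n-1\}^2$. For $p\nmid m$ and $\zeta\in\overline{\mathbb F_p}$ a primitive $m$-th root of unity, $\Omega_{m,p,\zeta;1}:=\{(i,j)\in\mathbb I_m\mid\zeta^i+\zeta^j=1\}$. $U_m$ is the group of units of $\mathbb Z/m\mathbb Z$, $[l]_m$ is the class of $l$; $U_m$ acts on $\mathbb I_m$ by multiplying both coordinates by $l$ and reducing modulo $m$. $\mathbb K_m$ is the set of pairs $(i,j)\in\mathbb I_{m-1}$ such that $ij>0$, $i\ne j$, and the stabilizer of $\zeta_m^i+\zeta_m^j$ in $\mathrm{Gal}(\mathbb Q(\zeta_m)/\mathbb Q)$ is trivial. Conditions (4) and (5) are read as quantified over all primitive $m$-th roots of unity $\zeta\in\mathbb F_p$ (which exist when $m\mid p-1$, as in condition (2)). *)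

theory Defs
  imports
    Complex_Main
    "HOL-Number_Theory.Number_Theory"
    "HOL-Algebra.Generated_Fields"
    "HOL-Algebra.Group_Action"
    "HOL-Algebra.Chinese_Remainder"
    "HOL-Algebra.Algebraic_Closure_Type"
    "Berlekamp_Zassenhaus.Finite_Field"
begin

text \<open>
  The prime field with \<open>p\<close> elements is the type \<open>'p mod_ring\<close> with \<open>'p :: prime_card\<close> and
  \<open>p = CARD('p)\<close>; its algebraic closure is \<open>'p mod_ring alg_closure\<close>.
\<close>

definition zeta :: "nat \<Rightarrow> complex" where
  "zeta m = exp (2 * of_real pi * \<i> / of_nat m)"

abbreviation complex_ring :: "complex ring" where
  "complex_ring \<equiv> ring_of_type_algebra"

text \<open>\<open>\<int>[\<zeta>\<^sub>m]\<close> and \<open>\<rat>(\<zeta>\<^sub>m)\<close> as subrings of \<open>\<complex>\<close>.\<close>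

definition cyclotomic_integers :: "nat \<Rightarrow> complex ring" where
  "cyclotomic_integers m = complex_ring\<lparr>carrier := generate_ring complex_ring {zeta m}\<rparr>"

definition cyclotomic_field :: "nat \<Rightarrow> complex ring" where
  "cyclotomic_field m = complex_ring\<lparr>carrier := generate_field complex_ring {zeta m}\<rparr>"

text \<open>Elements of \<^const>\<open>Bij\<close> are extensional, so an automorphism is a single HOL function
  and the trivial subgroup is a singleton.\<close>

definition galois_group :: "nat \<Rightarrow> (complex \<Rightarrow> complex) monoid" where
  "galois_group m =
     (let K = cyclotomic_field m in
       BijGroup (carrier K)\<lparr>carrier :=
         {\<sigma> \<in> Bij (carrier K). \<sigma> \<in> ring_iso K K \<and> (\<forall>q\<in>\<rat>. \<sigma> q = q)}\<rparr>)"

definition trivial_stabilizer :: "nat \<Rightarrow> complex \<Rightarrow> bool" where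
  "trivial_stabilizer m z \<longleftrightarrow>
     stabilizer (galois_group m) (\<lambda>\<sigma>. \<sigma>) z = {\<one>\<^bsub>galois_group m\<^esub>}"

definition index_pairs :: "nat \<Rightarrow> (nat \<times> nat) set" where
  "index_pairs n = {0..<n} \<times> {0..<n}"

definition KK :: "nat \<Rightarrow> (nat \<times> nat) set" where
  "KK m = {(i, j) \<in> index_pairs (m - 1).
     i * j > 0 \<and> i \<noteq> j \<and> trivial_stabilizer m (zeta m ^ i + zeta m ^ j)}"

definition primitive_unity_root :: "nat \<Rightarrow> 'a::field \<Rightarrow> bool" where
  "primitive_unity_root m z \<longleftrightarrow> z ^ m = 1 \<and> (\<forall>k. 0 < k \<and> k < m \<longrightarrow> z ^ k \<noteq> 1)"

definition Omega :: "nat \<Rightarrow> 'a::field \<Rightarrow> (nat \<times> nat) set" where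
  "Omega m z = {(i, j) \<in> index_pairs m. z ^ i + z ^ j = 1}"

text \<open>The action of the class of \<open>l\<close> modulo \<open>m\<close>, for \<open>l\<close> coprime to \<open>m\<close>, on pairs of residues.\<close>

definition unit_act :: "nat \<Rightarrow> nat \<Rightarrow> nat \<times> nat \<Rightarrow> nat \<times> nat" where
  "unit_act m l = (\<lambda>(i, j). (l * i mod m, l * j mod m))"

definition t_deg :: "'p::prime_card itself \<Rightarrow> nat \<Rightarrow> nat" where
  "t_deg _ m = Polynomial.degree (gcd ([:0, 1:] ^ m - 1) ((1 - [:0, 1:]) ^ m - 1) :: 'p mod_ring poly)"

end

(*
  Let n be the prime-to-p part of m and z a root, in characteristic p, of the n-th cyclotomic
  polynomial; z is a primitive n-th root of unity, so x = z^i and y = z^j. The norm of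
  1 - zeta^i - zeta^j from the n-th cyclotomic field is then an integer divisible by p, and it is
  nonzero because two complex roots of unity sum to 1 only if they are primitive sixth roots.
  Hence p is at most its absolute value, which is trivially at most 3^phi(n), and which is also
  less than 2^n if i and j differ: the mean of |1 - u^i - u^j|^2 over all n-th roots of unity u is
  then 3, so an arithmetic-geometric mean argument bounds the square of the norm by 3^n < 4^n.
  If i = j, then 2 z^i = 1 and p divides 2^n - 1.
*)
theory Submission
  imports Defs "HOL-Computational_Algebra.Fundamental_Theorem_Algebra"
begin

section \<open>Primitive roots of unity in an arbitrary field\<close>

lemma power_commute_exponents: "((x :: 'a :: monoid_mult) ^ a) ^ b = (x ^ b) ^ a"
  by (simp flip: power_mult add: mult.commute)

lemma primitive_unity_root_power_eq_1_iff:
  assumes "primitive_unity_root n w" "n > 0"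
  shows "w ^ a = 1 \<longleftrightarrow> n dvd a"
proof -
  have "w ^ a = w ^ (n * (a div n) + a mod n)"
    by simp
  also have "\<dots> = w ^ (a mod n)"
    using assms unfolding power_add power_mult by (simp add: primitive_unity_root_def)
  finally show ?thesis
    using assms mod_less_divisor[of n a]
    by (cases "a mod n = 0") (auto simp: primitive_unity_root_def dvd_eq_mod_eq_0)
qed

lemma primitive_unity_root_power_eq_iff:
  assumes "primitive_unity_root n w" "n > 0" "a \<le> b"
  shows "w ^ a = w ^ b \<longleftrightarrow> n dvd b - a"
proof -
  have "w \<noteq> 0"
    using assms by (auto simp: primitive_unity_root_def power_0_left)
  moreover have "w ^ b = w ^ a * w ^ (b - a)"
    using assms by (simp flip: power_add)
  ultimately show ?thesis
    using primitive_unity_root_power_eq_1_iff[OF assms(1,2), of "b - a"] by auto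
qed

text \<open>Either range of exponents has differences below \<open>n\<close>. The second one is
  there for \<open>totatives n\<close>, which omits 0 and contains \<open>n\<close> when
  \<open>n = 1\<close>.\<close>

lemma primitive_unity_root_inj_on:
  assumes "primitive_unity_root n w" "n > 0" "S \<subseteq> {..<n} \<or> S \<subseteq> {0<..n}"
  shows "inj_on (\<lambda>k. w ^ k) S"
proof -
  have *: "a = b" if "a \<in> S" "b \<in> S" "w ^ a = w ^ b" "a \<le> b" for a b
  proof -
    have "n dvd b - a"
      using primitive_unity_root_power_eq_iff assms that by blast
    moreover have "b - a < n"
      using assms(3)
    proof
      assume "S \<subseteq> {..<n}"
      hence "b < n"
        using that by auto
      thus ?thesis
        by simp
    next
      assume "S \<subseteq> {0<..n}"
      hence "a > 0" "b \<le> n"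
        using that by auto
      thus ?thesis
        using assms(2) by linarith
    qed
    ultimately show ?thesis
      using that by (auto dest: dvd_imp_le)
  qed
  show ?thesis
    by (rule inj_onI) (metis * nle_le)
qed

text \<open>The powers of \<open>w\<close> are already \<open>n\<close> distinct roots of
  \<open>X^n - 1\<close>, and a nonzero polynomial over a field has no more roots than its
  degree.\<close>

lemma primitive_unity_root_image:
  assumes "primitive_unity_root n (w :: 'a :: field)" "n > 0"
  shows "(\<lambda>k. w ^ k) ` {..<n} = {x. x ^ n = 1}"
proof (rule card_seteq)
  define q :: "'a poly" where "q = monom 1 n - 1"
  have "coeff q n = 1"
    using assms by (simp add: q_def)
  hence "q \<noteq> 0"
    by auto
  have roots: "{x. poly q x = 0} = {x. x ^ n = 1}"
    by (auto simp: q_def poly_monom)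
  show "finite {x :: 'a. x ^ n = 1}"
    using poly_roots_finite[OF \<open>q \<noteq> 0\<close>] roots by simp
  have "degree q \<le> n"
    unfolding q_def by (rule degree_diff_le) (auto simp: degree_monom_le)
  hence "card {x :: 'a. x ^ n = 1} \<le> n"
    using card_poly_roots_bound[OF \<open>q \<noteq> 0\<close>] roots by simp
  also have "n = card ((\<lambda>k. w ^ k) ` {..<n})"
    using primitive_unity_root_inj_on[OF assms] by (simp add: card_image)
  finally show "card {x :: 'a. x ^ n = 1} \<le> \<dots>" .
  have "(w ^ k) ^ n = 1" for k
    using assms power_commute_exponents[of w k n] by (simp add: primitive_unity_root_def)
  thus "(\<lambda>k. w ^ k) ` {..<n} \<subseteq> {x. x ^ n = 1}"
    by auto
qed

lemma bij_betw_totatives_primitive_unity_roots: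
  assumes "primitive_unity_root n (w :: 'a :: field)" "n > 0"
  shows "bij_betw (\<lambda>k. w ^ k) (totatives n) {u. primitive_unity_root n u}"
  unfolding bij_betw_def
proof (intro conjI equalityI subsetI)
  show "inj_on (\<lambda>k. w ^ k) (totatives n)"
    using assms totatives_subset by (intro primitive_unity_root_inj_on) auto
next
  fix u assume "u \<in> (\<lambda>k. w ^ k) ` totatives n"
  then obtain k where k: "coprime k n" "u = w ^ k"
    by (auto simp: in_totatives_iff)
  have "u ^ a = 1 \<longleftrightarrow> n dvd a" for a
    using k primitive_unity_root_power_eq_1_iff[OF assms, of "k * a"]
    by (simp add: power_mult coprime_commute coprime_dvd_mult_right_iff)
  thus "u \<in> {u. primitive_unity_root n u}"
    by (auto simp: primitive_unity_root_def dest: dvd_imp_le)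
next
  fix u :: 'a assume "u \<in> {u. primitive_unity_root n u}"
  hence u: "primitive_unity_root n u"
    by simp
  hence "u \<in> (\<lambda>k. w ^ k) ` {..<n}"
    unfolding primitive_unity_root_image[OF assms] by (simp add: primitive_unity_root_def)
  then obtain k0 where k0: "k0 < n" "u = w ^ k0"
    by auto
  \<comment> \<open>Exponent 0 is traded for \<open>n\<close>, since totatives are positive.\<close>
  define k where "k = (if k0 = 0 then n else k0)"
  have k: "0 < k" "k \<le> n" "u = w ^ k"
    using k0 assms by (auto simp: k_def primitive_unity_root_def)
  \<comment> \<open>If \<open>gcd k n\<close> exceeded 1, this power of \<open>u\<close> would give
    it an order smaller than \<open>n\<close>.\<close>
  have "u ^ (n div gcd k n) = w ^ (n * (k div gcd k n))"
    by (simp add: k flip: power_mult)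
       (metis div_mult_swap dvd_div_mult gcd_dvd1 gcd_dvd2 mult.commute)
  also have "\<dots> = 1"
    using assms by (simp add: power_mult primitive_unity_root_def)
  finally have "n dvd n div gcd k n"
    using primitive_unity_root_power_eq_1_iff[OF u assms(2)] by simp
  moreover have "n div gcd k n > 0"
    using assms by (simp add: div_greater_zero_iff)
  ultimately have "n \<le> n div gcd k n"
    by (rule dvd_imp_le)
  hence "coprime k n"
    using assms k by (metis coprime_iff_gcd_eq_1 div_less_dividend gcd_pos_nat leD less_one
        linorder_neqE_nat neq0_conv)
  thus "u \<in> (\<lambda>k. w ^ k) ` totatives n"
    using k by (auto simp: in_totatives_iff)
qed

lemma primitive_unity_root_cis:
  assumes "n > 0"
  shows "primitive_unity_root n (cis (2 * pi / real n))"
proof -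
  have *: "cis (2 * pi / real n) ^ k = cis (2 * pi * real k / real n)" for k
    by (simp add: DeMoivre mult_ac)
  have "cis (2 * pi / real n) ^ k \<noteq> 1" if "0 < k" "k < n" for k
    using bij_betw_imp_inj_on[OF bij_betw_roots_unity[OF assms], THEN inj_onD, of k 0] that
    unfolding * by auto
  thus ?thesis
    using assms by (auto simp: primitive_unity_root_def *)
qed

text \<open>The witness \<open>e\<close> is the multiplicative order of \<open>u\<close>.\<close>

lemma primitive_unity_root_exists_dvd:
  assumes "u ^ n = 1" "n > 0"
  shows "\<exists>e. e dvd n \<and> e > 0 \<and> primitive_unity_root e u"
proof -
  define e where "e = (LEAST e. e > 0 \<and> u ^ e = 1)"
  have e: "e > 0 \<and> u ^ e = 1"
    unfolding e_def by (rule LeastI[of _ n]) (use assms in simp)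
  have "primitive_unity_root e u"
    using e not_less_Least[of _ "\<lambda>e. e > 0 \<and> u ^ e = 1"]
    by (auto simp: primitive_unity_root_def e_def)
  thus ?thesis
    using e assms primitive_unity_root_power_eq_1_iff by blast
qed

lemma primitive_unity_root_unique:
  assumes "primitive_unity_root n u" "primitive_unity_root n' u" "n > 0" "n' > 0"
  shows "n = n'"
  using assms unfolding primitive_unity_root_def by (metis linorder_neqE_nat)

section \<open>Cyclotomic polynomials over the complex numbers\<close>

definition cyclotomic_poly :: "nat \<Rightarrow> complex poly" where
  "cyclotomic_poly n = (\<Prod>u | primitive_unity_root n u. [:-u, 1:])"

lemma finite_primitive_unity_roots:
  assumes "n > 0"
  shows "finite {u :: complex. primitive_unity_root n u}"
  by (rule finite_subset[OF _ finite_roots_unity[of n]])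
     (use assms in \<open>auto simp: primitive_unity_root_def\<close>)

lemma card_primitive_unity_roots:
  assumes "n > 0"
  shows "card {u :: complex. primitive_unity_root n u} = totient n"
  using bij_betw_same_card[OF bij_betw_totatives_primitive_unity_roots
      [OF primitive_unity_root_cis[OF assms] assms]]
  by (simp add: totient_def)

lemma lead_coeff_prod_linear: "lead_coeff (\<Prod>u\<in>A. [:-u, 1:] :: 'a :: idom poly) = 1"
  by (simp add: lead_coeff_prod)

lemma degree_cyclotomic_poly:
  assumes "n > 0"
  shows "degree (cyclotomic_poly n) = totient n"
  unfolding cyclotomic_poly_def
  by (subst degree_prod_eq_sum_degree) (auto simp: card_primitive_unity_roots[OF assms])

text \<open>The derivative of \<open>X^n - 1\<close> vanishes only at 0 or nowhere, so all complex
  roots are simple and the monic polynomial is the product of its linear factors.\<close>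

lemma unity_poly_eq_prod:
  assumes "n > 0"
  shows "monom 1 n - 1 = (\<Prod>u | u ^ n = (1 :: complex). [:-u, 1:])"
proof -
  define q :: "complex poly" where "q = monom 1 n - 1"
  have "rsquarefree q"
    unfolding rsquarefree_roots
    using assms by (auto simp: q_def poly_monom pderiv_diff pderiv_monom power_0_left)
  moreover have "degree q = n"
  proof (rule antisym)
    show "degree q \<le> n"
      unfolding q_def by (rule degree_diff_le) (auto simp: degree_monom_le)
    show "n \<le> degree q"
      using assms by (intro le_degree) (auto simp: q_def)
  qed
  hence "lead_coeff q = 1"
    using assms by (simp add: q_def)
  moreover have "{u. poly q u = 0} = {u. u ^ n = 1}"
    by (auto simp: q_def poly_monom)
  ultimately show ?thesis
    using complex_poly_decompose_rsquarefree[of q] by (simp add: q_def)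
qed

text \<open>The \<open>n\<close>-th roots of unity are sorted by their exact order \<open>e\<close>,
  a divisor of \<open>n\<close>.\<close>

lemma unity_poly_eq_prod_cyclotomic:
  assumes "n > 0"
  shows "monom 1 n - 1 = (\<Prod>e | e dvd n. cyclotomic_poly e)"
proof -
  have fin: "finite {e. e dvd n}"
    using assms by simp
  have "{u :: complex. u ^ n = 1} = (\<Union>e\<in>{e. e dvd n}. {u. primitive_unity_root e u})"
  proof (intro equalityI subsetI)
    fix u :: complex assume "u \<in> {u. u ^ n = 1}"
    thus "u \<in> (\<Union>e\<in>{e. e dvd n}. {u. primitive_unity_root e u})"
      using primitive_unity_root_exists_dvd[OF _ assms] by blast
  next
    fix u :: complex assume "u \<in> (\<Union>e\<in>{e. e dvd n}. {u. primitive_unity_root e u})"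
    thus "u \<in> {u. u ^ n = 1}"
      by (auto simp: primitive_unity_root_def power_mult elim!: dvdE)
  qed
  moreover have "(\<Prod>u\<in>(\<Union>e\<in>{e. e dvd n}. {u. primitive_unity_root e u}). [:-u, 1 :: complex:]) =
      (\<Prod>e | e dvd n. cyclotomic_poly e)"
    unfolding cyclotomic_poly_def
  proof (intro prod.UNION_disjoint fin ballI impI)
    fix e assume e: "e \<in> {e. e dvd n}"
    hence "e > 0"
      using assms by (auto intro: Nat.gr0I)
    thus "finite {u :: complex. primitive_unity_root e u}"
      by (rule finite_primitive_unity_roots)
    fix e' assume "e' \<in> {e. e dvd n}" "e \<noteq> e'"
    moreover from this have "e' > 0"
      using assms by (auto intro: Nat.gr0I)
    ultimately show "{u :: complex. primitive_unity_root e u} \<inter> {u. primitive_unity_root e' u} = {}"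
      using \<open>e > 0\<close> primitive_unity_root_unique by blast
  qed
  ultimately show ?thesis
    by (simp add: unity_poly_eq_prod[OF assms])
qed

section \<open>Monic division over the integers and integrality of cyclotomic polynomials\<close>

text \<open>Pseudo-division scales \<open>g\<close> by a power of the leading coefficient of
  \<open>f\<close>, which is 1 here.\<close>

lemma monic_int_poly_division:
  fixes f g :: "int poly"
  assumes "lead_coeff f = 1"
  shows "\<exists>q r. g = f * q + r \<and> (r = 0 \<or> degree r < degree f)"
proof -
  obtain q r where qr: "pseudo_divmod g f = (q, r)"
    by fastforce
  have "f \<noteq> 0"
    using assms by auto
  from pseudo_divmod[OF this qr] show ?thesis
    using assms by auto
qed

text \<open>A quotient by a monic integer polynomial taken over the complex numbers is already
  integral: otherwise the integral remainder would be a nonzero multiple of \<open>f\<close> of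
  smaller degree than \<open>f\<close>.\<close>

lemma of_int_poly_quotient:
  fixes h :: "complex poly"
  assumes "lead_coeff f = 1" "of_int_poly f * h = of_int_poly g"
  shows "\<exists>q. h = of_int_poly q \<and> f * q = g"
proof -
  obtain q r where qr: "g = f * q + r" "r = 0 \<or> degree r < degree f"
    using monic_int_poly_division[OF assms(1)] by blast
  have f0: "f \<noteq> 0"
    using assms by auto
  have eq: "of_int_poly f * (h - of_int_poly q) = (of_int_poly r :: complex poly)"
    using assms(2) by (simp add: qr(1) of_int_poly_hom.hom_add of_int_poly_hom.hom_mult algebra_simps)
  have "h - of_int_poly q = 0"
  proof (rule ccontr)
    assume *: "h - of_int_poly q \<noteq> 0"
    have "degree (of_int_poly r :: complex poly) = degree f + degree (h - of_int_poly q)"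
      unfolding eq[symmetric] using * f0 by (subst degree_mult_eq) auto
    moreover have "r \<noteq> 0"
      using eq * f0 by auto
    ultimately show False
      using qr by auto
  qed
  with eq qr show ?thesis
    by auto
qed

text \<open>Strong induction: \<open>X^n - 1\<close> is divided by the product \<open>G\<close> of
  the cyclotomic polynomials of the proper divisors of \<open>n\<close>, which is integral and
  monic.\<close>

lemma cyclotomic_poly_integral:
  assumes "n > 0"
  shows "\<exists>F. of_int_poly F = cyclotomic_poly n"
  using assms
proof (induction n rule: less_induct)
  case (less n)
  define D where "D = {e. e dvd n} - {n}"
  have "\<exists>F. of_int_poly F = cyclotomic_poly e" if "e \<in> D" for e
  proof -
    have "e dvd n" "e \<noteq> n"
      using that by (auto simp: D_def)
    moreover from this have "e \<le> n" "e > 0"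
      using less.prems by (auto intro: dvd_imp_le Nat.gr0I)
    ultimately show ?thesis
      by (intro less.IH) auto
  qed
  then obtain F where F: "\<And>e. e \<in> D \<Longrightarrow> of_int_poly (F e) = cyclotomic_poly e"
    by metis
  define G where "G = (\<Prod>e\<in>D. F e)"
  have eq: "of_int_poly G = (\<Prod>e\<in>D. cyclotomic_poly e)"
    unfolding G_def of_int_poly_hom.hom_prod by (rule prod.cong) (simp_all add: F)
  have "lead_coeff (of_int_poly G :: complex poly) = 1"
    unfolding eq by (simp add: lead_coeff_prod cyclotomic_poly_def)
  hence "lead_coeff G = 1"
    by simp
  moreover have "of_int_poly G * cyclotomic_poly n = of_int_poly (monom 1 n - 1)"
  proof -
    have "(\<Prod>e | e dvd n. cyclotomic_poly e) = cyclotomic_poly n * (\<Prod>e\<in>D. cyclotomic_poly e)"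
      unfolding D_def using less.prems by (intro prod.remove) auto
    thus ?thesis
      unfolding eq by (simp add: unity_poly_eq_prod_cyclotomic[OF less.prems, symmetric]
          of_int_poly_hom.hom_minus mult.commute)
  qed
  ultimately show ?case
    using of_int_poly_quotient by metis
qed

section \<open>Cyclotomic polynomials reduced to other fields\<close>

lemma poly_of_int_poly_unity:
  "poly (of_int_poly (monom 1 n - 1)) (z :: 'a :: comm_ring_1) = z ^ n - 1"
  by (simp add: of_int_poly_hom.hom_minus map_poly_monom poly_monom)

lemma lead_coeff_cyclotomic_integral:
  assumes "of_int_poly F = cyclotomic_poly n"
  shows "lead_coeff F = 1"
proof -
  have "lead_coeff (of_int_poly F :: complex poly) = 1"
    unfolding assms cyclotomic_poly_def by (rule lead_coeff_prod_linear)
  thus ?thesis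
    by simp
qed

lemma degree_cyclotomic_integral:
  assumes "of_int_poly F = cyclotomic_poly n" "n > 0"
  shows "degree F = totient n"
proof -
  have "degree (of_int_poly F :: complex poly) = totient n"
    unfolding assms(1) by (rule degree_cyclotomic_poly) fact
  thus ?thesis
    by simp
qed

text \<open>Since \<open>S\<close> avoids the primitive roots, \<open>F * E\<close> has distinct
  complex roots, all among the \<open>n\<close>-th roots of unity. The factorization then descends
  to the integers, from where it can be mapped into any field.\<close>

lemma cyclotomic_cofactor:
  fixes S :: "complex set"
  assumes F: "of_int_poly F = cyclotomic_poly n" and "n > 0"
    and S: "S \<subseteq> {u. u ^ n = 1}" "S \<inter> {u. primitive_unity_root n u} = {}"
    and E: "of_int_poly E = (\<Prod>u\<in>S. [:-u, 1:])"
  shows "\<exists>H. F * E * H = monom 1 n - 1"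
proof -
  let ?A = "{u :: complex. u ^ n = 1}" and ?B = "{u :: complex. primitive_unity_root n u} \<union> S"
  have fin: "finite ?A"
    using assms by (intro finite_roots_unity) simp
  have sub: "?B \<subseteq> ?A"
    using S by (auto simp: primitive_unity_root_def)
  have "of_int_poly (F * E) = (\<Prod>u\<in>?B. [:-u, 1 :: complex:])"
    unfolding of_int_poly_hom.hom_mult F E cyclotomic_poly_def
    by (rule prod.union_disjoint[symmetric])
       (use S sub finite_subset[OF _ fin] in auto)
  moreover have "lead_coeff E = 1"
  proof -
    have "lead_coeff (of_int_poly E :: complex poly) = 1"
      unfolding E by (rule lead_coeff_prod_linear)
    thus ?thesis
      by simp
  qed
  hence "lead_coeff (F * E) = 1"
    using lead_coeff_cyclotomic_integral[OF F] by (simp add: lead_coeff_mult)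
  moreover have "(\<Prod>u\<in>?B. [:-u, 1 :: complex:]) * (\<Prod>u\<in>?A - ?B. [:-u, 1:]) = monom 1 n - 1"
    unfolding unity_poly_eq_prod[OF \<open>n > 0\<close>] prod.subset_diff[OF sub fin] by (rule mult.commute)
  moreover have "monom 1 n - 1 = (of_int_poly (monom 1 n - 1) :: complex poly)"
    by (simp add: of_int_poly_hom.hom_minus map_poly_monom)
  ultimately show ?thesis
    using of_int_poly_quotient by metis
qed

text \<open>If the order \<open>e\<close> of \<open>z\<close> were less than \<open>n\<close>, both
  \<open>F\<close> and \<open>X^e - 1\<close> would vanish at \<open>z\<close>. Their product
  divides \<open>X^n - 1\<close>, so \<open>z\<close> would be a double root, although the
  derivative \<open>n * z ^ (n - 1)\<close> is nonzero.\<close>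

lemma cyclotomic_root_primitive:
  fixes z :: "'a :: field"
  assumes F: "of_int_poly F = cyclotomic_poly n" and "n > 0" and n: "of_nat n \<noteq> (0 :: 'a)"
    and root: "poly (of_int_poly F) z = 0"
  shows "primitive_unity_root n z"
proof -
  have "\<exists>H. F * 1 * H = monom 1 n - 1"
    by (rule cyclotomic_cofactor[OF F \<open>n > 0\<close>, of "{}"]) auto
  then obtain H where H: "F * H = monom 1 n - 1"
    by auto
  have "poly (of_int_poly (F * H)) z = 0"
    using root by (simp add: of_int_poly_hom.hom_mult)
  hence zn: "z ^ n = 1"
    unfolding H poly_of_int_poly_unity by simp
  obtain e where e: "e dvd n" "e > 0" "primitive_unity_root e z"
    using primitive_unity_root_exists_dvd[OF zn \<open>n > 0\<close>] by blast
  have "e = n"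
  proof (rule ccontr)
    assume "e \<noteq> n"
    hence "e < n"
      using e \<open>n > 0\<close> by (auto dest: dvd_imp_le)
    have "\<exists>H. F * (monom 1 e - 1) * H = monom 1 n - 1"
    proof (rule cyclotomic_cofactor[OF F \<open>n > 0\<close>, of "{u. u ^ e = 1}"])
      show "{u :: complex. u ^ e = 1} \<subseteq> {u. u ^ n = 1}"
      proof (intro subsetI CollectI)
        fix u :: complex assume "u \<in> {u. u ^ e = 1}"
        thus "u ^ n = 1"
          using e(1) by (elim dvdE) (simp add: power_mult)
      qed
      show "{u :: complex. u ^ e = 1} \<inter> {u. primitive_unity_root n u} = {}"
        using e \<open>e < n\<close> by (auto simp: primitive_unity_root_def)
      show "of_int_poly (monom 1 e - 1) = (\<Prod>u | u ^ e = 1. [:-u, 1 :: complex:])"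
        unfolding unity_poly_eq_prod[OF e(2), symmetric]
        by (simp add: of_int_poly_hom.hom_minus map_poly_monom)
    qed
    then obtain H where H: "F * (monom 1 e - 1) * H = monom 1 n - 1"
      by blast
    define A B :: "'a poly" where "A = of_int_poly F" and "B = of_int_poly ((monom 1 e - 1) * H)"
    have "A * B = of_int_poly (monom 1 n - 1)"
      unfolding A_def B_def H[symmetric] mult.assoc by (rule of_int_poly_hom.hom_mult[symmetric])
    also have "\<dots> = monom 1 n - 1"
      by (simp add: of_int_poly_hom.hom_minus map_poly_monom)
    finally have AB: "A * B = monom 1 n - 1" .
    have "poly B z = 0"
      unfolding B_def of_int_poly_hom.hom_mult poly_mult poly_of_int_poly_unity
      using e by (simp add: primitive_unity_root_def)
    \<comment> \<open>Both factors vanish at \<open>z\<close>, so each summand of the product rule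
      does.\<close>
    hence "poly (pderiv (A * B)) z = 0"
      using root by (simp add: pderiv_mult A_def)
    hence "of_nat n * z ^ (n - 1) = 0"
      unfolding AB by (simp add: pderiv_diff pderiv_monom poly_monom)
    thus False
      using n zn \<open>n > 0\<close> by (auto simp: power_0_left)
  qed
  thus ?thesis
    using e by simp
qed

lemma cyclotomic_has_root:
  assumes F: "of_int_poly F = cyclotomic_poly n" and "n > 0"
  shows "\<exists>z :: 'a :: alg_closed_field. poly (of_int_poly F) z = 0"
proof (rule alg_closed_imp_poly_has_root)
  have "degree F = totient n"
    by (rule degree_cyclotomic_integral) fact+
  hence "0 < degree F"
    using \<open>n > 0\<close> by simp
  \<comment> \<open>The leading coefficient 1 survives in any characteristic, so the degree does not
    drop.\<close>
  also have "coeff (of_int_poly F :: 'a poly) (degree F) \<noteq> 0"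
    using lead_coeff_cyclotomic_integral[OF F] by simp
  hence "degree F \<le> degree (of_int_poly F :: 'a poly)"
    by (rule le_degree)
  finally show "0 < degree (of_int_poly F :: 'a poly)" .
qed

section \<open>The norm from the cyclotomic field and its reduction\<close>

text \<open>
  The product over \<open>k\<close> of \<open>h(X\<^sup>k)\<close> takes the same value at all roots of the cyclotomic
  polynomial, so its remainder modulo that polynomial is constant: this is the norm, and it
  reduces to the value of the product at \<open>z\<close>.
\<close>

lemma cyclotomic_norm:
  fixes z :: "'a :: field"
  assumes F: "of_int_poly F = cyclotomic_poly n" and "n > 0"
    and root: "poly (of_int_poly F) z = 0" and h: "poly (of_int_poly h) z = 0"
  shows "\<exists>c. of_int c = (\<Prod>u | primitive_unity_root n u. poly (of_int_poly h) u :: complex) \<and>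
    of_int c = (0 :: 'a)"
proof -
  let ?R = "{u :: complex. primitive_unity_root n u}"
  define N where "N = (\<Prod>u\<in>?R. poly (of_int_poly h) u)"
  define P where "P = (\<Prod>k\<in>totatives n. pcompose h (monom 1 k))"
  have P_poly: "poly (of_int_poly P) w = (\<Prod>k\<in>totatives n. poly (of_int_poly h) (w ^ k))"
    for w :: "'b :: field"
    by (simp add: P_def of_int_poly_hom.hom_prod poly_prod of_int_hom.map_poly_pcompose
        poly_pcompose map_poly_monom poly_monom)
  have P_N: "poly (of_int_poly P) w = N" if "w \<in> ?R" for w
    unfolding P_poly N_def
    using bij_betw_totatives_primitive_unity_roots[OF _ \<open>n > 0\<close>, of w] that
    by (intro prod.reindex_bij_betw) auto
  \<comment> \<open>The factor for \<open>k = 1\<close> is the value of \<open>h\<close> at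
    \<open>z\<close>.\<close>
  have "poly (of_int_poly P) z = 0"
    unfolding P_poly using h \<open>n > 0\<close> by (intro prod_zero bexI[of _ 1]) auto
  obtain q r where qr: "P = F * q + r" "r = 0 \<or> degree r < degree F"
    using monic_int_poly_division[OF lead_coeff_cyclotomic_integral[OF F]] by blast
  have deg: "degree F = totient n"
    by (rule degree_cyclotomic_integral) fact+
  \<comment> \<open>This difference vanishes at all \<open>totient n\<close> primitive roots but has
    smaller degree, so it is zero and \<open>r\<close> is the constant \<open>N\<close>; being an
    integer polynomial, \<open>r\<close> makes \<open>N\<close> an integer.\<close>
  define d :: "complex poly" where "d = of_int_poly r - [:N:]"
  have "d = 0"
  proof (rule ccontr)
    assume "d \<noteq> 0"
    have "poly d w = 0" if "w \<in> ?R" for w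
    proof -
      have "poly (of_int_poly F) w = 0"
        unfolding F cyclotomic_poly_def poly_prod
        using that finite_primitive_unity_roots[OF \<open>n > 0\<close>] by (intro prod_zero) auto
      thus ?thesis
        using P_N[OF that]
        by (simp add: d_def qr(1) of_int_poly_hom.hom_add of_int_poly_hom.hom_mult)
    qed
    hence "card ?R \<le> card {w. poly d w = 0}"
      using poly_roots_finite[OF \<open>d \<noteq> 0\<close>] by (intro card_mono) auto
    also have "\<dots> \<le> degree d"
      by (rule card_poly_roots_bound) fact
    also have "\<dots> < totient n"
      unfolding d_def using qr(2) \<open>n > 0\<close> by (intro degree_diff_less) (auto simp: deg)
    finally show False
      by (simp add: card_primitive_unity_roots[OF \<open>n > 0\<close>])
  qed
  hence r: "of_int_poly r = [:N:]"
    by (simp add: d_def)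
  hence "degree (of_int_poly r :: complex poly) = 0"
    by simp
  hence "degree r = 0"
    by simp
  then obtain c where c: "r = [:c:]"
    by (rule degree_eq_zeroE)
  have "of_int c = N"
    using arg_cong[OF r, of "\<lambda>q. coeff q 0"] by (simp add: c)
  moreover have "of_int c = (0 :: 'a)"
    using \<open>poly (of_int_poly P) z = 0\<close> root
    by (simp add: qr(1) c of_int_poly_hom.hom_add of_int_poly_hom.hom_mult
        of_int_hom.map_poly_pCons_hom)
  ultimately have "of_int c = N \<and> of_int c = (0 :: 'a)"
    by (rule conjI)
  thus ?thesis
    unfolding N_def by (rule exI)
qed

section \<open>Mean squares over the roots of unity\<close>

text \<open>Multiplication by a primitive root \<open>w\<close> permutes the roots of unity and
  scales the sum by \<open>w ^ k\<close>, which is not 1.\<close>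

lemma sum_unity_roots_power:
  assumes "n > 0" "\<not> n dvd k"
  shows "(\<Sum>u | u ^ n = (1 :: complex). u ^ k) = 0"
proof -
  define w where "w = cis (2 * pi / real n)"
  have w: "primitive_unity_root n w"
    unfolding w_def by (rule primitive_unity_root_cis) fact
  hence "w ^ n = 1" "w \<noteq> 0" "w ^ k \<noteq> 1"
    using assms primitive_unity_root_power_eq_1_iff[OF w]
    by (auto simp: primitive_unity_root_def w_def)
  have "bij_betw (\<lambda>u. w * u) {u. u ^ n = 1} {u. u ^ n = 1}"
    by (rule bij_betw_byWitness[where f' = "\<lambda>u. u / w"])
       (use \<open>w ^ n = 1\<close> \<open>w \<noteq> 0\<close> in \<open>auto simp: power_mult_distrib power_divide\<close>)
  hence "(\<Sum>u | u ^ n = 1. u ^ k) = (\<Sum>u | u ^ n = 1. (w * u) ^ k)"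
    by (rule sum.reindex_bij_betw[symmetric])
  also have "\<dots> = w ^ k * (\<Sum>u | u ^ n = 1. u ^ k)"
    by (simp add: power_mult_distrib sum_distrib_left)
  finally show ?thesis
    using \<open>w ^ k \<noteq> 1\<close> by simp
qed

lemma unity_root_norm:
  assumes "u ^ n = (1 :: complex)" "n > 0"
  shows "cmod u = 1"
proof -
  have "cmod u ^ n = 1"
    using assms by (simp flip: norm_power)
  thus ?thesis
    using assms power_eq_1_iff by fastforce
qed

text \<open>This is Parseval for the coefficients 1, -1, -1: after expanding the square, every
  nonconstant term sums to zero over the roots of unity.\<close>

lemma sum_unity_roots_trinomial:
  assumes "0 < i" "i < n" "0 < j" "j < n" "i \<noteq> j"
  shows "(\<Sum>u | u ^ n = 1. (cmod (1 - u ^ i - u ^ j))\<^sup>2) = 3 * real n"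
proof -
  let ?U = "{u :: complex. u ^ n = 1}"
  \<comment> \<open>Writing conjugates as \<open>u ^ (n - k)\<close> keeps all exponents natural
    numbers.\<close>
  have inv: "u ^ k * u ^ (n - k) = 1 \<and> cnj (u ^ k) = u ^ (n - k)" if "u \<in> ?U" "k < n" for u k
  proof -
    have 1: "u ^ k * u ^ (n - k) = 1"
      using that by (simp flip: power_add)
    have "cmod (u ^ k) = 1"
      using unity_root_norm[of u n] that by (simp add: norm_power)
    hence "u ^ k * cnj (u ^ k) = 1"
      unfolding complex_norm_square[symmetric] by simp
    hence "u ^ k * cnj (u ^ k) = u ^ k * u ^ (n - k)"
      using 1 by simp
    moreover have "u ^ k \<noteq> 0"
      using 1 by (metis mult_zero_left zero_neq_one)
    ultimately show ?thesis
      using 1 by (metis mult_left_cancel)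
  qed
  have "complex_of_real (\<Sum>u\<in>?U. (cmod (1 - u ^ i - u ^ j))\<^sup>2) =
      (\<Sum>u\<in>?U. 3 - u ^ i - u ^ j - u ^ (n - i) - u ^ (n - j) + u ^ (i + (n - j)) + u ^ (j + (n - i)))"
    unfolding of_real_sum
  proof (rule sum.cong[OF refl])
    fix u assume u: "u \<in> ?U"
    have "complex_of_real ((cmod (1 - u ^ i - u ^ j))\<^sup>2) =
        (1 - u ^ i - u ^ j) * (1 - u ^ (n - i) - u ^ (n - j))"
      unfolding complex_norm_square using inv[OF u \<open>i < n\<close>] inv[OF u \<open>j < n\<close>] by simp
    also have "\<dots> = 1 + u ^ i * u ^ (n - i) + u ^ j * u ^ (n - j)
        - u ^ i - u ^ j - u ^ (n - i) - u ^ (n - j) + u ^ (i + (n - j)) + u ^ (j + (n - i))"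
      by (simp add: algebra_simps power_add)
    finally show "complex_of_real ((cmod (1 - u ^ i - u ^ j))\<^sup>2) =
        3 - u ^ i - u ^ j - u ^ (n - i) - u ^ (n - j) + u ^ (i + (n - j)) + u ^ (j + (n - i))"
      using inv[OF u \<open>i < n\<close>] inv[OF u \<open>j < n\<close>] by simp
  qed
  also have "\<dots> = 3 * of_nat n"
  proof -
    have not_dvd_between: "\<not> n dvd a" if "0 < a" "a < 2 * n" "a \<noteq> n" for a
    proof
      assume "n dvd a"
      then obtain q where "a = n * q"
        by (elim dvdE)
      hence "0 < q" "q < 2"
        using that by auto
      thus False
        using that \<open>a = n * q\<close> by (simp add: less_2_cases_iff)
    qed
    \<comment> \<open>These exponents lie strictly between 0 and \<open>2 * n\<close>, and they
      differ from \<open>n\<close> because \<open>i \<noteq> j\<close>.\<close>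
    have "\<not> n dvd i + (n - j)" "\<not> n dvd j + (n - i)"
      by (rule not_dvd_between; use assms in linarith)+
    moreover have "\<not> n dvd i" "\<not> n dvd j" "\<not> n dvd n - i" "\<not> n dvd n - j"
      using assms by (auto dest: dvd_imp_le)
    moreover have "card ?U = n"
      using assms by (intro card_roots_unity_eq) simp
    ultimately show ?thesis
      using assms by (simp add: sum.distrib sum_subtractf sum_unity_roots_power)
  qed
  finally have "complex_of_real (\<Sum>u\<in>?U. (cmod (1 - u ^ i - u ^ j))\<^sup>2) = complex_of_real (3 * real n)"
    by simp
  thus ?thesis
    unfolding of_real_eq_iff .
qed

section \<open>Bounds for the norm\<close>

text \<open>
  Tangent-line bound at the mean value 3; it gives the arithmetic-geometric mean estimate for a
  product over a subset from the sum over all roots of unity.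
\<close>

lemma le_3_exp: "x \<le> 3 * exp (x / 3 - 1 :: real)"
  using exp_ge_add_one_self[of "x / 3 - 1"] by simp

lemma cyclotomic_norm_trinomial_less:
  assumes "0 < i" "i < n" "0 < j" "j < n" "i \<noteq> j"
  shows "cmod (\<Prod>u | primitive_unity_root n u. 1 - u ^ i - u ^ j) < 2 ^ n"
proof -
  let ?R = "{u :: complex. primitive_unity_root n u}" and ?U = "{u :: complex. u ^ n = 1}"
  define a where "a u = (cmod (1 - u ^ i - u ^ j))\<^sup>2" for u
  have n: "n > 0"
    using assms by simp
  have "card ?R = totient n"
    by (rule card_primitive_unity_roots[OF n])
  have "(cmod (\<Prod>u\<in>?R. 1 - u ^ i - u ^ j))\<^sup>2 = (\<Prod>u\<in>?R. a u)"
    by (simp add: a_def prod_power_distrib prod_norm[symmetric])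
  also have "\<dots> \<le> (\<Prod>u\<in>?R. 3 * exp (a u / 3 - 1))"
    by (intro prod_mono conjI le_3_exp) (simp add: a_def)
  also have "\<dots> = 3 ^ totient n * exp ((\<Sum>u\<in>?R. a u) / 3 - real (totient n))"
    using finite_primitive_unity_roots[OF n] \<open>card ?R = totient n\<close>
    by (simp add: prod.distrib exp_sum[symmetric] sum_subtractf sum_divide_distrib)
  \<comment> \<open>All terms are nonnegative, so the sum may be enlarged to all \<open>n\<close>-th
    roots of unity, where its value is known.\<close>
  also have "(\<Sum>u\<in>?R. a u) \<le> (\<Sum>u\<in>?U. a u)"
    using n finite_roots_unity[of n] by (intro sum_mono2) (auto simp: a_def primitive_unity_root_def)
  also have "(\<Sum>u\<in>?U. a u) = 3 * real n"
    unfolding a_def by (rule sum_unity_roots_trinomial) fact+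
  also have "exp (3 * real n / 3 - real (totient n)) = exp 1 ^ (n - totient n)"
    by (simp add: exp_of_nat_mult[symmetric] of_nat_diff totient_le)
  \<comment> \<open>The price of the enlargement is a factor \<open>exp 1 \<le> 3\<close> for each
    of the \<open>n - totient n\<close> additional roots, for a total of
    \<open>3 ^ n\<close>.\<close>
  also have "\<dots> \<le> 3 ^ (n - totient n)"
    by (intro power_mono exp_le) auto
  also have "3 ^ totient n * \<dots> = (3 ^ n :: real)"
    by (simp add: power_add[symmetric] totient_le)
  also have "\<dots> < 4 ^ n"
    using n by (intro power_strict_mono) auto
  also have "(4 ^ n :: real) = (2 ^ n)\<^sup>2"
    by (simp add: power2_eq_square flip: power_mult_distrib)
  finally show ?thesis
    by (simp add: power_less_imp_less_base)
qed

lemma cyclotomic_norm_trinomial_le: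
  assumes "n > 0"
  shows "cmod (\<Prod>u | primitive_unity_root n u. 1 - u ^ i - u ^ j) \<le> 3 ^ totient n"
proof -
  have "cmod (\<Prod>u | primitive_unity_root n u. 1 - u ^ i - u ^ j) \<le>
      (\<Prod>u | primitive_unity_root n (u :: complex). 3)"
    unfolding prod_norm[symmetric]
  proof (intro prod_mono conjI)
    fix u :: complex assume "u \<in> {u. primitive_unity_root n u}"
    hence "cmod u = 1"
      using assms by (intro unity_root_norm) (auto simp: primitive_unity_root_def)
    thus "cmod (1 - u ^ i - u ^ j) \<le> 3"
      using norm_triangle_ineq4[of "1 - u ^ i" "u ^ j"] norm_triangle_ineq4[of 1 "u ^ i"]
      by (simp add: norm_power)
  qed simp
  thus ?thesis
    by (simp add: card_primitive_unity_roots[OF assms])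
qed

section \<open>Complex roots of unity with sum 1\<close>

text \<open>On the unit circle, \<open>u\<close> and \<open>1 - u\<close> both having norm 1 forces
  \<open>cnj u = 1 - u\<close>. Hence \<open>u\<close> is a root of the sixth cyclotomic polynomial
  \<open>X^2 - X + 1\<close>, and its order 6 divides \<open>n\<close>.\<close>

lemma unity_roots_sum_eq_1:
  assumes "u ^ n = 1" "v ^ n = 1" "u + v = (1 :: complex)" "n > 0"
  shows "6 dvd n"
proof -
  have "cmod u = 1" "cmod v = 1"
    using assms unity_root_norm by blast+
  have v: "v = 1 - u"
    using assms by (simp add: eq_diff_eq add.commute)
  have "u * cnj u = 1" "(1 - u) * (1 - cnj u) = 1"
    using \<open>cmod u = 1\<close> \<open>cmod v = 1\<close> v complex_norm_square[of u] complex_norm_square[of "1 - u"]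
    by simp_all
  hence "cnj u = 1 - u"
    by (simp add: algebra_simps)
  hence "u * (1 - u) = 1"
    using \<open>u * cnj u = 1\<close> by simp
  hence u2: "u ^ 2 = u - 1"
    by (simp add: algebra_simps power2_eq_square add_eq_0_iff)
  have "u ^ 3 = u * u ^ 2"
    by (simp add: power3_eq_cube power2_eq_square)
  also have "\<dots> = u * u - u"
    unfolding u2 by (simp add: right_diff_distrib)
  finally have u3: "u ^ 3 = -1"
    by (simp add: u2 flip: power2_eq_square)
  have powers: "u ^ 4 = -u" "u ^ 5 = 1 - u" "u ^ 6 = 1"
    using u2 u3 power_add[of u 3 1] power_add[of u 3 2] power_add[of u 3 3] by simp_all
  \<comment> \<open>These values would make some power below the sixth equal to 1; for instance
    \<open>u ^ 2 = u - 1\<close> is 1 only for \<open>u = 2\<close>.\<close>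
  have neq: "u \<noteq> 1" "u \<noteq> 0" "u \<noteq> -1" "u \<noteq> 2"
    using u2 \<open>cmod u = 1\<close> by auto
  hence "-u \<noteq> 1"
    by (metis minus_minus)
  have "u ^ k \<noteq> 1" if "0 < k" "k < 6" for k
  proof -
    have "k = 1 \<or> k = 2 \<or> k = 3 \<or> k = 4 \<or> k = 5"
      using that by arith
    thus ?thesis
      by (elim disjE) (use u2 u3 powers neq \<open>-u \<noteq> 1\<close> in simp_all)
  qed
  hence "primitive_unity_root 6 u"
    using powers by (simp add: primitive_unity_root_def)
  thus ?thesis
    using assms primitive_unity_root_power_eq_1_iff[of 6 u n] by simp
qed

section \<open>Contradiction in characteristic \<open>p\<close>\<close>

lemma no_unity_roots_sum_eq_1:
  fixes z :: "'a :: field"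
  assumes F: "of_int_poly F = cyclotomic_poly n" and "n > 0" and "\<not> 6 dvd n"
    and p: "CHAR('a) = p" "p > min (2 ^ n - 1) (3 ^ totient n)"
    and root: "poly (of_int_poly F) z = 0" and prim: "primitive_unity_root n z"
    and ij: "i < n" "j < n"
  shows "z ^ i + z ^ j \<noteq> 1"
proof
  assume sum: "z ^ i + z ^ j = 1"
  let ?R = "{u :: complex. primitive_unity_root n u}"
  \<comment> \<open>\<open>h\<close> vanishes at \<open>z\<close> by assumption, so its norm
    \<open>c\<close> is an integer that becomes 0 in characteristic \<open>p\<close>.\<close>
  define h :: "int poly" where "h = 1 - monom 1 i - monom 1 j"
  have h: "poly (of_int_poly h) w = 1 - w ^ i - w ^ j" for w :: "'b :: field"
    by (simp add: h_def of_int_poly_hom.hom_minus map_poly_monom poly_monom)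
  have "poly (of_int_poly h) z = 0"
    using sum by (simp add: h algebra_simps)
  then obtain c where c: "of_int c = (\<Prod>u\<in>?R. 1 - u ^ i - u ^ j)" "of_int c = (0 :: 'a)"
    using cyclotomic_norm[OF F \<open>n > 0\<close> root, of h] unfolding h by auto
  have "c \<noteq> 0"
  proof
    assume "c = 0"
    hence "(\<Prod>u\<in>?R. 1 - u ^ i - u ^ j) = 0"
      using c by simp
    then obtain u where u: "u \<in> ?R" "1 - u ^ i - u ^ j = 0"
      using finite_primitive_unity_roots[OF \<open>n > 0\<close>] by (auto simp: prod_zero_iff)
    hence "(u ^ k) ^ n = 1" for k
      using power_commute_exponents[of u k n] by (simp add: primitive_unity_root_def)
    moreover have "u ^ i + u ^ j = 1"
      using u by (simp add: algebra_simps)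
    ultimately show False
      using unity_roots_sum_eq_1 \<open>n > 0\<close> \<open>\<not> 6 dvd n\<close> by blast
  qed
  have "int p dvd c"
    using c(2) p(1) by (simp add: of_int_eq_0_iff_char_dvd)
  hence "int p \<le> \<bar>c\<bar>"
    using \<open>c \<noteq> 0\<close> dvd_imp_le_int[of c "int p"] by simp
  hence "real_of_int (int p) \<le> real_of_int \<bar>c\<bar>"
    unfolding of_int_le_iff .
  also have "real_of_int \<bar>c\<bar> = cmod (\<Prod>u\<in>?R. 1 - u ^ i - u ^ j)"
    unfolding c(1)[symmetric] by simp
  finally have p_le: "real p \<le> cmod (\<Prod>u\<in>?R. 1 - u ^ i - u ^ j)"
    by simp
  also have "\<dots> \<le> 3 ^ totient n"
    by (rule cyclotomic_norm_trinomial_le) fact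
  finally have "p \<le> 3 ^ totient n"
    unfolding of_nat_le_iff[where 'a = real, symmetric] by simp
  \<comment> \<open>The trivial bound rules out one side of the minimum, so the other side must lie
    below \<open>p\<close>.\<close>
  hence p_ge: "p > 2 ^ n - 1"
    using p(2) by linarith
  \<comment> \<open>The mean-square bound needs distinct exponents. If they agree, raising
    \<open>2 * z ^ i = 1\<close> to the power \<open>n\<close> gives \<open>2 ^ n = 1\<close>,
    against \<open>p > 2 ^ n - 1\<close>.\<close>
  have "i \<noteq> j"
  proof
    assume "i = j"
    have zn: "(z ^ i) ^ n = 1"
      using prim power_commute_exponents[of z i n] by (simp add: primitive_unity_root_def)
    have "2 * z ^ i = 1"
      using sum \<open>i = j\<close> by simp
    hence "(2 * z ^ i) ^ n = 1"
      by simp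
    hence "(2 :: 'a) ^ n = 1"
      unfolding power_mult_distrib zn by simp
    hence "of_nat (2 ^ n - 1) = (0 :: 'a)"
      by (simp add: of_nat_diff)
    hence "p dvd 2 ^ n - 1"
      unfolding of_nat_eq_0_iff_char_dvd p(1) .
    moreover have "(2 :: nat) ^ n > 1"
      using \<open>n > 0\<close> by (intro one_less_power) auto
    ultimately show False
      using p_ge dvd_imp_le[of p "2 ^ n - 1"] by linarith
  qed
  \<comment> \<open>A zero exponent would make the other power of \<open>z\<close> vanish.\<close>
  moreover have "i \<noteq> 0" "j \<noteq> 0"
    using sum prim \<open>n > 0\<close> by (auto simp: primitive_unity_root_def power_0_left)
  ultimately have "cmod (\<Prod>u\<in>?R. 1 - u ^ i - u ^ j) < 2 ^ n"
    using ij by (intro cyclotomic_norm_trinomial_less) auto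
  hence "real p < 2 ^ n"
    using p_le by linarith
  hence "p < 2 ^ n"
    unfolding of_nat_less_iff[where 'a = real, symmetric] by simp
  thus False
    using p_ge by simp
qed

text \<open>By Frobenius, \<open>(x ^ n - 1)\<close> raised to a power of the characteristic is
  \<open>x ^ (CHAR('a) ^ k * n) - 1 = 0\<close>, and a field has no nilpotents.\<close>

lemma unity_root_prime_char:
  fixes x :: "'a :: field"
  assumes "Factorial_Ring.prime CHAR('a)" "x ^ (CHAR('a) ^ k * n) = 1"
  shows "x ^ n = 1"
proof -
  have "(x ^ n - 1 + 1) ^ (CHAR('a) ^ k) = (x ^ n - 1) ^ (CHAR('a) ^ k) + 1 ^ (CHAR('a) ^ k)"
    using assms(1) by (intro freshmans_dream') auto
  hence "(x ^ n - 1) ^ (CHAR('a) ^ k) = 0"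
    using assms(2) by (simp add: power_mult[symmetric] mult.commute)
  thus ?thesis
    unfolding power_eq_0_iff by simp
qed

text \<open>Removing the \<open>p\<close>-part of \<open>m\<close> keeps \<open>x\<close> and
  \<open>y\<close> roots of unity and makes the order \<open>n\<close> invertible, so that a root of
  the cyclotomic polynomial is primitive and generates them.\<close>

lemma no_unity_roots_sum_eq_1_alg_closed:
  fixes x y :: "'a :: alg_closed_field"
  assumes "m > 0" and "\<not> 6 dvd m"
    and p: "Factorial_Ring.prime p" "CHAR('a) = p" "p > min (2 ^ m - 1) (3 ^ totient m)"
    and "x ^ m = 1" "y ^ m = 1"
  shows "x + y \<noteq> 1"
proof -
  have "m \<noteq> 0" "\<not> is_unit p"
    using \<open>m > 0\<close> prime_gt_1_nat[OF p(1)] by auto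
  then obtain k n where n: "m = p ^ k * n" "\<not> p dvd n"
    using multiplicity_decompose'[of m p] by blast
  have "n dvd m"
    unfolding n(1) by (rule dvd_triv_right)
  hence "n > 0" "n \<le> m"
    using \<open>m > 0\<close> by (auto intro: Nat.gr0I dvd_imp_le)
  have xy: "x ^ n = 1" "y ^ n = 1"
    using unity_root_prime_char[of x k n] unity_root_prime_char[of y k n]
      assms(6,7) p(1) unfolding p(2) n(1)[symmetric] by blast+
  obtain F where F: "of_int_poly F = cyclotomic_poly n"
    using cyclotomic_poly_integral[OF \<open>n > 0\<close>] by blast
  obtain z :: 'a where root: "poly (of_int_poly F) z = 0"
    using cyclotomic_has_root[OF F \<open>n > 0\<close>] by blast
  have "of_nat n \<noteq> (0 :: 'a)"
    using n(2) p(2) by (simp add: of_nat_eq_0_iff_char_dvd)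
  with root have prim: "primitive_unity_root n z"
    by (intro cyclotomic_root_primitive[OF F \<open>n > 0\<close>])
  then obtain i j where ij: "i < n" "x = z ^ i" "j < n" "y = z ^ j"
    using primitive_unity_root_image[OF prim \<open>n > 0\<close>] xy by blast
  \<comment> \<open>Both sides of the minimum can only shrink from \<open>m\<close> to its divisor
    \<open>n\<close>, so the lower bound on \<open>p\<close> persists.\<close>
  have "(2 :: nat) ^ n \<le> 2 ^ m" "(3 :: nat) ^ totient n \<le> 3 ^ totient m"
    using \<open>n \<le> m\<close> totient_dvd_mono[OF \<open>n dvd m\<close> \<open>m > 0\<close>] by simp_all
  hence "p > min (2 ^ n - 1) (3 ^ totient n)"
    using p(3) by linarith
  moreover have "\<not> 6 dvd n"
    using \<open>\<not> 6 dvd m\<close> \<open>n dvd m\<close> dvd_trans by blast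
  ultimately show ?thesis
    using no_unity_roots_sum_eq_1[OF F \<open>n > 0\<close> _ p(2) _ root prim] ij by simp
qed

theorem corollary3p6:
  fixes m p :: nat
  assumes "m > 0" and "\<not> 6 dvd m"
    and "p = CARD('p::prime_card)"
    and "p > min (2 ^ m - 1) (3 ^ totient m)"
    and "\<not> ((5 \<le> m \<and> m < 2 ^ m \<and> 2 ^ m \<le> p \<and> p \<le> 3 ^ totient m \<and> odd m)
          \<and> (cyclotomic_integers m Quot (PIdl\<^bsub>cyclotomic_integers m\<^esub> (of_nat p))
               \<simeq> RDirProd_list (replicate (totient m) (ring_of_type_algebra :: 'p mod_ring ring))
             \<and> m dvd p - 1)
          \<and> (t_deg TYPE('p) m > 0 \<and> even (t_deg TYPE('p) m))
          \<and> (\<forall>z :: 'p mod_ring. primitive_unity_root m z \<longrightarrow>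
               (\<forall>l. coprime l m \<and> \<not> [l = 1] (mod m) \<longrightarrow>
                  Omega m z \<inter> unit_act m l ` Omega m z = {}))
          \<and> (\<forall>z :: 'p mod_ring. primitive_unity_root m z \<longrightarrow>
               (\<forall>(i, j) \<in> Omega m z. trivial_stabilizer m (zeta m ^ i + zeta m ^ j)))
          \<and> (card (KK m) \<ge> 2 * t_deg TYPE('p) m * (totient m - 1)
             \<and> int (t_deg TYPE('p) m) * (int (totient m) - 1) \<le> (int m - 1) * (int m - 3)))"
  shows "\<not> (\<exists>x y :: 'p mod_ring alg_closure. x ^ m = 1 \<and> y ^ m = 1 \<and> x + y = 1)"
proof -
  have "CHAR('p mod_ring alg_closure) = p"
    using assms(3) by (simp add: semiring_char_mod_ring)
  moreover have "Factorial_Ring.prime p"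
    unfolding assms(3) by (rule prime_card)
  ultimately show ?thesis
    using no_unity_roots_sum_eq_1_alg_closed[where 'a = "'p mod_ring alg_closure"] assms(1,2,4)
    by blast
qed

end
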